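(* Let $n\ge 1$ be an integer and let $m\in\{2,3,4\}$. Then the tree $CB(n,m)$ is friendly to every finite tree that has the same number of edges as $CB(n,m)$.
   Context: All trees are finite. The $n$-star is the tree with vertices $0,1,\ldots,n$ and edges $(0,1),(0,2),\ldots,(0,n)$. $CB(n_1,n_2)$ (for integers $n_1,n_2\ge1$) denotes the union of an $n_1$-star and an $n_2$-star along one common edge: it consists of two adjacent vertices $C_1\ne C_2$ (the centers of the two stars) together with $n_1-1$ further leaves attached to $C_1$ and $n_2-1$ further leaves attached to $C_2$. So $\deg C_1=n_1$, $\deg C_2=n_2$, and it has $n_1+n_2-1$ edges. The path between two distinct edges of a tree is the path joining some endpoint of the first to some endpoint of the second and containing neither of the two edges. For two subsets $p,q$ of the edge set of a tree: $p$ does not catch on $q$ if $p\cap q=\varnothing$ and for any two edges of $p$ the path in the tree between them contains an even number of edges of $q$; $p$ and $q$ are unlinked if $p$ does not catch on $q$ and $q$ does not catch on $p$. The coboundary $\delta P$ of a vertex $P$ is the set of edges incident to $P$. A tree $G_1$ is friendly to a tree $G_2$ if there is a bijection $\varphi:E(G_1)\to E(G_2)$ such that for any two distinct vertices $P,Q$ of $G_1$ joined by a path with an even number of edges, the sets $\varphi(\delta P)$ and $\varphi(\delta Q)$ are unlinked in $G_2$. *)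

theory Defs
  imports Main
begin

text \<open>
  Finite simple undirected graphs; an edge is the two-element set of its endpoints.
\<close>

record 'a ugraph =
  verts :: "'a set"
  edges :: "'a set set"

definition simple_ugraph :: "'a ugraph \<Rightarrow> bool" where
  "simple_ugraph G \<longleftrightarrow> finite (verts G) \<and> (\<forall>e\<in>edges G. e \<subseteq> verts G \<and> card e = 2)"

fun walk_edges :: "'a list \<Rightarrow> 'a set list" where
  "walk_edges [] = []"
| "walk_edges [x] = []"
| "walk_edges (x # y # xs) = {x, y} # walk_edges (y # xs)"

text \<open>
  Paths are given by their nonempty list of pairwise distinct vertices; the one-vertex list
  is the path without edges.
\<close>

definition path_between :: "'a ugraph \<Rightarrow> 'a \<Rightarrow> 'a list \<Rightarrow> 'a \<Rightarrow> bool" where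
  "path_between G u xs v \<longleftrightarrow>
     xs \<noteq> [] \<and> hd xs = u \<and> last xs = v \<and> distinct xs \<and>
     set xs \<subseteq> verts G \<and> set (walk_edges xs) \<subseteq> edges G"

definition connected_ugraph :: "'a ugraph \<Rightarrow> bool" where
  "connected_ugraph G \<longleftrightarrow>
     verts G \<noteq> {} \<and> (\<forall>u\<in>verts G. \<forall>v\<in>verts G. \<exists>xs. path_between G u xs v)"

definition is_cycle :: "'a ugraph \<Rightarrow> 'a list \<Rightarrow> bool" where
  "is_cycle G xs \<longleftrightarrow>
     length xs \<ge> 3 \<and> path_between G (hd xs) xs (last xs) \<and> {last xs, hd xs} \<in> edges G"

definition is_tree :: "'a ugraph \<Rightarrow> bool" where
  "is_tree G \<longleftrightarrow> simple_ugraph G \<and> connected_ugraph G \<and> (\<nexists>xs. is_cycle G xs)"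

definition edge_path :: "'a ugraph \<Rightarrow> 'a set \<Rightarrow> 'a list \<Rightarrow> 'a set \<Rightarrow> bool" where
  "edge_path G e xs f \<longleftrightarrow>
     (\<exists>u\<in>e. \<exists>v\<in>f. path_between G u xs v) \<and>
     e \<notin> set (walk_edges xs) \<and> f \<notin> set (walk_edges xs)"

text \<open>
  In a tree there is exactly one \<open>edge_path\<close> between two distinct edges, so the universal
  quantifier over \<open>xs\<close> below speaks about that path.
\<close>

definition catches_on :: "'a ugraph \<Rightarrow> 'a set set \<Rightarrow> 'a set set \<Rightarrow> bool" where
  "catches_on G p q \<longleftrightarrow>
     \<not> (p \<inter> q = {} \<and>
        (\<forall>e\<in>p. \<forall>f\<in>p. e \<noteq> f \<longrightarrow>
           (\<forall>xs. edge_path G e xs f \<longrightarrow> even (card (set (walk_edges xs) \<inter> q)))))"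

definition unlinked :: "'a ugraph \<Rightarrow> 'a set set \<Rightarrow> 'a set set \<Rightarrow> bool" where
  "unlinked G p q \<longleftrightarrow> \<not> catches_on G p q \<and> \<not> catches_on G q p"

definition coboundary :: "'a ugraph \<Rightarrow> 'a \<Rightarrow> 'a set set" where
  "coboundary G P = {e \<in> edges G. P \<in> e}"

definition friendly :: "'a ugraph \<Rightarrow> 'b ugraph \<Rightarrow> bool" where
  "friendly G\<^sub>1 G\<^sub>2 \<longleftrightarrow>
     (\<exists>\<phi>. bij_betw \<phi> (edges G\<^sub>1) (edges G\<^sub>2) \<and>
        (\<forall>P\<in>verts G\<^sub>1. \<forall>Q\<in>verts G\<^sub>1.
           P \<noteq> Q \<and> (\<exists>xs. path_between G\<^sub>1 P xs Q \<and> even (length (walk_edges xs))) \<longrightarrow>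
           unlinked G\<^sub>2 (\<phi> ` coboundary G\<^sub>1 P) (\<phi> ` coboundary G\<^sub>1 Q)))"

text \<open>
  \<open>is_CB n\<^sub>1 n\<^sub>2 G\<close> says that \<open>G\<close> is a copy of \<open>CB(n\<^sub>1, n\<^sub>2)\<close>, for \<open>n\<^sub>1, n\<^sub>2 \<ge> 1\<close>:
  centers \<open>c\<^sub>1, c\<^sub>2\<close> with leaf sets \<open>A, B\<close>.
\<close>

definition is_CB :: "nat \<Rightarrow> nat \<Rightarrow> 'a ugraph \<Rightarrow> bool" where
  "is_CB n\<^sub>1 n\<^sub>2 G \<longleftrightarrow> 1 \<le> n\<^sub>1 \<and> 1 \<le> n\<^sub>2 \<and>
     (\<exists>c\<^sub>1 c\<^sub>2 A B. c\<^sub>1 \<noteq> c\<^sub>2 \<and>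
        finite A \<and> card A = n\<^sub>1 - 1 \<and> finite B \<and> card B = n\<^sub>2 - 1 \<and>
        A \<inter> B = {} \<and> {c\<^sub>1, c\<^sub>2} \<inter> (A \<union> B) = {} \<and>
        verts G = {c\<^sub>1, c\<^sub>2} \<union> A \<union> B \<and>
        edges G = {{c\<^sub>1, c\<^sub>2}} \<union> (\<lambda>a. {c\<^sub>1, a}) ` A \<union> (\<lambda>b. {c\<^sub>2, b}) ` B)"

lemma is_CB_exists:
  assumes "1 \<le> n\<^sub>1" "1 \<le> n\<^sub>2"
  shows "\<exists>G :: nat ugraph. is_CB n\<^sub>1 n\<^sub>2 G"
proof -
  define A where "A = {2..<n\<^sub>1 + 1}"
  define B where "B = {n\<^sub>1 + 1..<n\<^sub>1 + n\<^sub>2}"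
  have AB: "finite A" "card A = n\<^sub>1 - 1" "finite B" "card B = n\<^sub>2 - 1" "A \<inter> B = {}"
    "{0, 1} \<inter> (A \<union> B) = {}"
    using assms by (auto simp: A_def B_def)
  have "is_CB n\<^sub>1 n\<^sub>2 \<lparr>verts = {0, 1} \<union> A \<union> B,
     edges = {{0, 1}} \<union> (\<lambda>a. {0, a}) ` A \<union> (\<lambda>b. {1, b}) ` B\<rparr>"
    unfolding is_CB_def
    by (intro conjI exI[of _ 0] exI[of _ 1] exI[of _ A] exI[of _ B]) (use AB assms in simp_all)
  then show ?thesis by blast
qed

lemma is_CB_card_edges:
  assumes "is_CB n\<^sub>1 n\<^sub>2 G"
  shows "card (edges G) = n\<^sub>1 + n\<^sub>2 - 1"
proof -
  from assms obtain c\<^sub>1 c\<^sub>2 A B where n: "1 \<le> n\<^sub>1" "1 \<le> n\<^sub>2" and c: "c\<^sub>1 \<noteq> c\<^sub>2"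
    and A: "finite A" "card A = n\<^sub>1 - 1" and B: "finite B" "card B = n\<^sub>2 - 1"
    and d: "A \<inter> B = {}" "{c\<^sub>1, c\<^sub>2} \<inter> (A \<union> B) = {}"
    and E: "edges G = {{c\<^sub>1, c\<^sub>2}} \<union> (\<lambda>a. {c\<^sub>1, a}) ` A \<union> (\<lambda>b. {c\<^sub>2, b}) ` B"
    unfolding is_CB_def by (elim conjE exE) (rule that; assumption)
  have "inj_on (\<lambda>a. {c\<^sub>1, a}) A" "inj_on (\<lambda>b. {c\<^sub>2, b}) B"
    using d by (auto simp: inj_on_def doubleton_eq_iff)
  then have "card ((\<lambda>a. {c\<^sub>1, a}) ` A) = n\<^sub>1 - 1" "card ((\<lambda>b. {c\<^sub>2, b}) ` B) = n\<^sub>2 - 1"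
    using A B by (simp_all add: card_image)
  moreover have "(\<lambda>a. {c\<^sub>1, a}) ` A \<inter> (\<lambda>b. {c\<^sub>2, b}) ` B = {}"
    using c d by (auto simp: doubleton_eq_iff)
  moreover have "{c\<^sub>1, c\<^sub>2} \<notin> (\<lambda>a. {c\<^sub>1, a}) ` A \<union> (\<lambda>b. {c\<^sub>2, b}) ` B"
    using c d by (auto simp: doubleton_eq_iff)
  ultimately have "card (insert {c\<^sub>1, c\<^sub>2} ((\<lambda>a. {c\<^sub>1, a}) ` A \<union> (\<lambda>b. {c\<^sub>2, b}) ` B))
      = Suc ((n\<^sub>1 - 1) + (n\<^sub>2 - 1))"
    using A B by (simp add: card_Un_disjoint)
  then show ?thesis using n by (simp add: E)
qed

lemma walk_edges_nth: "Suc i < length xs \<Longrightarrow> {xs ! i, xs ! Suc i} \<in> set (walk_edges xs)"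
proof (induction xs arbitrary: i rule: walk_edges.induct)
  case (3 x y xs)
  then show ?case by (cases i) auto
qed auto

lemma cycle_two_neighbours:
  assumes "is_cycle G xs" "x \<in> set xs"
  obtains y z where "y \<noteq> z" "{x, y} \<in> edges G" "{x, z} \<in> edges G"
proof -
  from assms have len: "length xs \<ge> 3" and ne: "xs \<noteq> []" and dist: "distinct xs"
    and E: "set (walk_edges xs) \<subseteq> edges G" and closing: "{last xs, hd xs} \<in> edges G"
    by (auto simp: is_cycle_def path_between_def)
  have step: "{xs ! i, xs ! Suc i} \<in> edges G" if "Suc i < length xs" for i
    using walk_edges_nth[OF that] E by blast
  obtain i where i: "i < length xs" "x = xs ! i"
    using assms(2) by (auto simp: in_set_conv_nth)
  define n where "n = length xs - 1"
  have n: "n \<ge> 2" "length xs = Suc n" using len by (auto simp: n_def)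
  have closing': "{xs ! n, xs ! 0} \<in> edges G"
    using closing ne by (simp add: last_conv_nth hd_conv_nth n_def)
  define j where "j = (if i = n then 0 else Suc i)"
  define k where "k = (if i = 0 then n else i - 1)"
  have "j < length xs" "k < length xs" "j \<noteq> k"
    using i n by (auto simp: j_def k_def split: if_splits)
  then have "xs ! j \<noteq> xs ! k" using dist by (simp add: nth_eq_iff_index_eq)
  moreover have "{x, xs ! j} \<in> edges G"
    using closing' step[of i] i n by (auto simp: j_def)
  moreover have "{x, xs ! k} \<in> edges G"
    using closing' step[of "i - 1"] i n by (auto simp: k_def insert_commute)
  ultimately show ?thesis using that by blast
qed

lemma is_CB_is_tree:
  assumes "is_CB n\<^sub>1 n\<^sub>2 G"
  shows "is_tree G"
proof -
  from assms obtain c\<^sub>1 c\<^sub>2 A B where c: "c\<^sub>1 \<noteq> c\<^sub>2"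
    and fin: "finite A" "finite B"
    and AB: "A \<inter> B = {}" "{c\<^sub>1, c\<^sub>2} \<inter> (A \<union> B) = {}"
    and V: "verts G = {c\<^sub>1, c\<^sub>2} \<union> A \<union> B"
    and E: "edges G = {{c\<^sub>1, c\<^sub>2}} \<union> (\<lambda>a. {c\<^sub>1, a}) ` A \<union> (\<lambda>b. {c\<^sub>2, b}) ` B"
    unfolding is_CB_def by (elim conjE exE) (rule that; assumption)
  have d: "A \<inter> B = {}" "c\<^sub>1 \<notin> A" "c\<^sub>1 \<notin> B" "c\<^sub>2 \<notin> A" "c\<^sub>2 \<notin> B"
    using AB by auto
  have "simple_ugraph G"
    using c d fin by (auto simp: simple_ugraph_def V E card_2_iff)
  moreover have "connected_ugraph G"
  proof -
    have mem: "{c\<^sub>1, c\<^sub>2} \<in> edges G" "{c\<^sub>2, c\<^sub>1} \<in> edges G"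
      "a \<in> A \<Longrightarrow> {c\<^sub>1, a} \<in> edges G" "a \<in> A \<Longrightarrow> {a, c\<^sub>1} \<in> edges G"
      "a \<in> B \<Longrightarrow> {c\<^sub>2, a} \<in> edges G" "a \<in> B \<Longrightarrow> {a, c\<^sub>2} \<in> edges G" for a
      by (auto simp: E insert_commute)
    have "\<exists>xs. path_between G u xs v" if "u \<in> verts G" "v \<in> verts G" for u v
    proof (cases "u = v")
      case True
      then show ?thesis
        using that by (intro exI[of _ "[u]"]) (simp add: path_between_def)
    next
      case False
      define f where "f x = (if x \<in> {c\<^sub>1} \<union> A then c\<^sub>1 else c\<^sub>2)" for x
      define xs where "xs = remdups_adj ([u, f u, f v, v])"
      have u: "u = c\<^sub>1 \<or> u = c\<^sub>2 \<or> u \<in> A \<or> u \<in> B" and v: "v = c\<^sub>1 \<or> v = c\<^sub>2 \<or> v \<in> A \<or> v \<in> B"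
        using that by (auto simp: V)
      have "path_between G u xs v"
        using u v
        by (elim disjE; use False c d mem that in
              \<open>auto simp: path_between_def xs_def f_def V\<close>)
      then show ?thesis ..
    qed
    then show ?thesis by (auto simp: connected_ugraph_def V)
  qed
  moreover have "\<not> is_cycle G xs" for xs
  proof
    assume cyc: "is_cycle G xs"
    have "x \<in> {c\<^sub>1, c\<^sub>2}" if "x \<in> set xs" for x
    proof (rule cycle_two_neighbours[OF cyc that])
      fix y z assume yz: "y \<noteq> z" "{x, y} \<in> edges G" "{x, z} \<in> edges G"
      then show "x \<in> {c\<^sub>1, c\<^sub>2}"
        using c d by (auto simp: E doubleton_eq_iff)
    qed
    then have "card (set xs) \<le> card {c\<^sub>1, c\<^sub>2}" by (intro card_mono) auto
    moreover have "card (set xs) \<ge> 3"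
      using cyc by (simp add: is_cycle_def path_between_def distinct_card)
    ultimately show False using c by simp
  qed
  ultimately show ?thesis by (auto simp: is_tree_def)
qed

end

theory Submission
  imports Defs
begin

text \<open>
  Write \<open>k = m - 1\<close>. It suffices to find in the tree \<open>T\<close> an edge \<open>c\<close> and a set \<open>X\<close> of \<open>k\<close> other
  edges such that \<open>X\<close> and the set \<open>Y\<close> of the remaining edges meet only at the endpoints of \<open>c\<close>:
  send the central edge of \<open>CB(n, m)\<close> to \<open>c\<close>, the leaf edges at \<open>C\<^sub>2\<close> to \<open>X\<close> and those at \<open>C\<^sub>1\<close>
  to \<open>Y\<close>. A path between two edges outside \<open>X\<close> that uses an edge of \<open>X\<close> enters and leaves \<open>X\<close> at
  the two endpoints of \<open>c\<close> and so closes up to a cycle; the same holds for \<open>Y\<close>.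

  To find \<open>c\<close> and \<open>X\<close>, start from a leaf edge \<open>c\<close> and shrink: take \<open>X\<close> of minimal size at least \<open>k\<close>
  among the edge sets meeting the rest of the tree only in one endpoint \<open>v\<close> of an edge \<open>c\<close>
  outside \<open>X\<close>. If the size is not \<open>k\<close>, minimality applied to the branches of \<open>X\<close> at \<open>v\<close> leaves only
  \<open>k = 3\<close> and two branches of size 2. Then use the edge at \<open>v\<close> of one branch as the new
  \<open>c\<close>; the other edge of that branch and the whole other branch form \<open>X\<close>.
\<close>

text \<open>For a vertex \<open>v\<close> of a tree these sets are exactly the unions of branches at
  \<open>v\<close>.\<close>

definition attached_at :: "'a ugraph \<Rightarrow> 'a \<Rightarrow> 'a set set \<Rightarrow> bool" where
  "attached_at G v X \<longleftrightarrow> X \<subseteq> edges G \<and> (\<forall>e\<in>X. \<forall>f\<in>edges G - X. e \<inter> f \<subseteq> {v})"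

text \<open>Contacts are allowed at both ends of \<open>c\<close>, not at one fixed vertex: the
  exceptional case with \<open>k = 3\<close> needs a set that hangs partly on each end. The
  condition is symmetric in \<open>X\<close> and the remaining edges.\<close>

definition splits_at_edge :: "'a ugraph \<Rightarrow> 'a set \<Rightarrow> 'a set set \<Rightarrow> bool" where
  "splits_at_edge G c X \<longleftrightarrow> c \<in> edges G \<and> X \<subseteq> edges G - {c} \<and>
     (\<forall>e\<in>X. \<forall>f\<in>edges G - X - {c}. e \<inter> f \<subseteq> c)"

text \<open>For distinct vertices this is the component of \<open>v\<close> after deletion of
  \<open>u\<close>.\<close>

definition branch_verts :: "'a ugraph \<Rightarrow> 'a \<Rightarrow> 'a \<Rightarrow> 'a set" where
  "branch_verts G u v = {(x, y). {x, y} \<in> edges G \<and> x \<noteq> u \<and> y \<noteq> u}\<^sup>* `` {v}"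

definition branch :: "'a ugraph \<Rightarrow> 'a \<Rightarrow> 'a \<Rightarrow> 'a set set" where
  "branch G u v = {e \<in> edges G. e \<inter> branch_verts G u v \<noteq> {}}"

section \<open>Walks, paths and edges of trees\<close>

lemma set_walk_edges: "set (walk_edges xs) = {{xs ! i, xs ! Suc i} |i. Suc i < length xs}"
proof (induction xs rule: walk_edges.induct)
  case (3 x y xs)
  have "{{(x # y # xs) ! i, (x # y # xs) ! Suc i} |i. Suc i < length (x # y # xs)}
      = insert {x, y} {{(y # xs) ! i, (y # xs) ! Suc i} |i. Suc i < length (y # xs)}"
    (is "?L = ?R")
  proof
    show "?L \<subseteq> ?R"
    proof
      fix e assume "e \<in> ?L"
      then obtain i where "e = {(x # y # xs) ! i, (x # y # xs) ! Suc i}" "Suc i < length (x # y # xs)"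
        by blast
      then show "e \<in> ?R" by (cases i) auto
    qed
    show "?R \<subseteq> ?L"
    proof
      fix e assume "e \<in> ?R"
      then consider "e = {x, y}" | i where "e = {(y # xs) ! i, (y # xs) ! Suc i}" "Suc i < length (y # xs)"
        by blast
      then show "e \<in> ?L"
      proof cases
        case 1
        then show ?thesis by (auto intro!: exI[of _ 0])
      next
        case 2
        then show ?thesis by (auto intro!: exI[of _ "Suc i"])
      qed
    qed
  qed
  with 3 show ?case by simp
qed auto

lemma walk_edges_take_drop:
  "set (walk_edges (drop i (take j xs))) \<subseteq> set (walk_edges xs)"
proof
  fix e assume "e \<in> set (walk_edges (drop i (take j xs)))"
  then obtain k where k: "e = {drop i (take j xs) ! k, drop i (take j xs) ! Suc k}"
      "Suc k < length (drop i (take j xs))"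
    unfolding set_walk_edges by blast
  moreover from k have "i \<le> length xs" "i \<le> j" by simp_all
  ultimately show "e \<in> set (walk_edges xs)"
    unfolding set_walk_edges by (intro CollectI exI[of _ "i + k"]) (simp add: ac_simps)
qed

lemma walk_edges_snoc:
  "xs \<noteq> [] \<Longrightarrow> walk_edges (xs @ [y]) = walk_edges xs @ [{last xs, y}]"
  by (induction xs rule: walk_edges.induct) auto

lemma tree_edgeE:
  assumes "is_tree G" "e \<in> edges G" "v \<in> e"
  obtains w where "e = {v, w}" "v \<noteq> w" "v \<in> verts G" "w \<in> verts G"
proof -
  have "e \<subseteq> verts G" "card e = 2"
    using assms by (auto simp: is_tree_def simple_ugraph_def)
  then show ?thesis
    using assms(3) that by (auto simp: card_2_iff)
qed

lemma tree_edge_neq: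
  assumes "is_tree G" "{u, v} \<in> edges G" shows "u \<noteq> v"
proof -
  have "card {u, v} = 2" using assms by (auto simp: is_tree_def simple_ugraph_def)
  then show ?thesis by auto
qed

lemma finite_edges:
  assumes "is_tree G" shows "finite (edges G)"
proof -
  have "edges G \<subseteq> Pow (verts G)" "finite (verts G)"
    using assms by (auto simp: is_tree_def simple_ugraph_def)
  then show ?thesis by (meson finite_Pow_iff finite_subset)
qed

text \<open>Otherwise the segment from position \<open>i\<close> to position \<open>j\<close> has at
  least three vertices and closes up to a cycle.\<close>

lemma path_chord_free:
  assumes "is_tree G" "path_between G u xs v" "i < j" "j < length xs" "{xs ! i, xs ! j} \<in> edges G"
  shows "j = Suc i"
proof (rule ccontr)
  assume "j \<noteq> Suc i"
  define ys where "ys = drop i (take (Suc j) xs)"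
  have len: "length ys \<ge> 3" using assms \<open>j \<noteq> Suc i\<close> by (auto simp: ys_def)
  have "hd ys = xs ! i" "last ys = xs ! j"
    using assms by (auto simp: ys_def hd_drop_conv_nth last_conv_nth)
  moreover have "set ys \<subseteq> set xs"
    unfolding ys_def by (meson order_trans set_drop_subset set_take_subset)
  moreover have "distinct ys" using assms by (simp add: ys_def path_between_def)
  moreover have "set (walk_edges ys) \<subseteq> set (walk_edges xs)"
    unfolding ys_def by (rule walk_edges_take_drop)
  ultimately have "is_cycle G ys"
    using assms len by (auto simp: is_cycle_def path_between_def insert_commute)
  then show False using assms(1) by (auto simp: is_tree_def)
qed

section \<open>Attached sets and branches\<close>

lemma attached_atD:
  "attached_at G v X \<Longrightarrow> e \<in> X \<Longrightarrow> f \<in> edges G - X \<Longrightarrow> e \<inter> f \<subseteq> {v}"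
  by (simp add: attached_at_def)

lemma attached_at_diff:
  "attached_at G v X \<Longrightarrow> attached_at G v Y \<Longrightarrow> attached_at G v (X - Y)"
  unfolding attached_at_def by blast

lemma attached_at_splits:
  "attached_at G v X \<Longrightarrow> c \<in> edges G - X \<Longrightarrow> v \<in> c \<Longrightarrow> splits_at_edge G c X"
  unfolding attached_at_def splits_at_edge_def by blast

lemma branch_verts_refl: "v \<in> branch_verts G u v"
  by (simp add: branch_verts_def)

lemma branch_verts_step:
  assumes "x \<in> branch_verts G u v" "{x, y} \<in> edges G" "x \<noteq> u" "y \<noteq> u"
  shows "y \<in> branch_verts G u v"
  using assms unfolding branch_verts_def by (auto intro: rtrancl_into_rtrancl)

lemma branch_verts_induct [consumes 1, case_names refl step]:
  assumes "x \<in> branch_verts G u v" "P v"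
    and "\<And>x y. x \<in> branch_verts G u v \<Longrightarrow> P x \<Longrightarrow> {x, y} \<in> edges G \<Longrightarrow> x \<noteq> u \<Longrightarrow> y \<noteq> u \<Longrightarrow> P y"
  shows "P x"
proof -
  have "(v, x) \<in> {(x, y). {x, y} \<in> edges G \<and> x \<noteq> u \<and> y \<noteq> u}\<^sup>*"
    using assms(1) by (simp add: branch_verts_def)
  then show ?thesis
    by (induction rule: rtrancl_induct) (use assms(2,3) in \<open>auto simp: branch_verts_def\<close>)
qed

text \<open>A path is extended vertex by vertex; when the new vertex already lies on the path, the
  path is cut off there instead, so it stays simple.\<close>

lemma branch_verts_path:
  assumes "is_tree G" "x \<in> branch_verts G u v" "v \<in> verts G" "u \<noteq> v"
  shows "\<exists>xs. path_between G v xs x \<and> u \<notin> set xs"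
  using assms(2)
proof (induction rule: branch_verts_induct)
  case refl
  then show ?case using assms by (intro exI[of _ "[v]"]) (auto simp: path_between_def)
next
  case (step x y)
  then obtain xs where xs: "path_between G v xs x" "u \<notin> set xs" by blast
  show ?case
  proof (cases "y \<in> set xs")
    case True
    then obtain i where i: "i < length xs" "y = xs ! i" by (auto simp: in_set_conv_nth)
    have "path_between G v (take (Suc i) xs) y"
      using xs i walk_edges_take_drop[of 0 "Suc i" xs] set_take_subset[of "Suc i" xs]
      by (auto simp: path_between_def last_conv_nth)
    then show ?thesis using xs(2) by (meson in_set_takeD)
  next
    case False
    have "y \<in> verts G" using assms(1) step by (auto simp: is_tree_def simple_ugraph_def)
    then have "path_between G v (xs @ [y]) y"
      using xs False step by (auto simp: path_between_def walk_edges_snoc)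
    then show ?thesis using xs step by (intro exI[of _ "xs @ [y]"]) auto
  qed
qed

lemma branch_verts_root:
  assumes "u \<noteq> v" shows "u \<notin> branch_verts G u v"
proof -
  have "x \<noteq> u" if "x \<in> branch_verts G u v" for x
    using that by (induction rule: branch_verts_induct) (use assms in auto)
  then show ?thesis by blast
qed

text \<open>Prepending \<open>u\<close> to a path from \<open>v\<close> to \<open>x\<close> that
  avoids \<open>u\<close> gives a path whose ends are joined by \<open>{u, x}\<close>. A path has no
  chords, so this path is a single edge.\<close>

lemma branch_verts_edge_root:
  assumes "is_tree G" "{u, v} \<in> edges G" "{u, x} \<in> edges G" "x \<in> branch_verts G u v"
  shows "x = v"
proof -
  have uv: "u \<noteq> v" "v \<in> verts G" "u \<in> verts G"
    using tree_edge_neq[OF assms(1,2)] assms(1,2) by (auto simp: is_tree_def simple_ugraph_def)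
  obtain xs where xs: "path_between G v xs x" "u \<notin> set xs"
    using branch_verts_path assms(1,4) uv by metis
  then have ne: "xs \<noteq> []" "hd xs = v" "last xs = x" by (auto simp: path_between_def)
  then have "walk_edges (u # xs) = {u, v} # walk_edges xs" by (cases xs) auto
  then have p: "path_between G u (u # xs) x"
    using xs ne uv assms(2) by (auto simp: path_between_def)
  have "length xs = Suc 0"
    using assms(3) ne by (intro path_chord_free[OF assms(1) p]) (auto simp: last_conv_nth nth_Cons')
  then show ?thesis using ne by (cases xs) auto
qed

context
  fixes G :: "'a ugraph" and u v :: 'a
  assumes tree: "is_tree G" and edge: "{u, v} \<in> edges G"
begin

lemma edge_in_branch: "{u, v} \<in> branch G u v"
  using edge by (simp add: branch_def branch_verts_refl)

text \<open>A vertex other than \<open>u\<close> on an edge of the branch lies in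
  \<open>branch_verts G u v\<close>, and then every edge at that vertex belongs to the
  branch.\<close>

lemma attached_at_branch: "attached_at G u (branch G u v)"
proof -
  have "x = u" if e: "e \<in> branch G u v" "f \<in> edges G" "f \<notin> branch G u v" "x \<in> e" "x \<in> f" for e f x
  proof (rule ccontr)
    assume "x \<noteq> u"
    obtain y where y: "y \<in> e" "y \<in> branch_verts G u v" using e by (auto simp: branch_def)
    have "e \<in> edges G" using e by (simp add: branch_def)
    have "y \<noteq> u"
      using branch_verts_root[of u v G] y tree_edge_neq[OF tree edge] by auto
    have "x = y \<or> e = {y, x}"
      using tree_edgeE[OF tree \<open>e \<in> edges G\<close> \<open>y \<in> e\<close>] e by auto
    then have "x \<in> branch_verts G u v"
      using branch_verts_step y \<open>y \<noteq> u\<close> \<open>x \<noteq> u\<close> \<open>e \<in> edges G\<close> by metis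
    then show False using e by (auto simp: branch_def)
  qed
  then show ?thesis by (auto simp: attached_at_def branch_def)
qed

text \<open>No edge of the branch except \<open>{u, v}\<close> contains \<open>u\<close>. So the
  others are disjoint from all edges outside the branch and can meet \<open>{u, v}\<close> only in
  \<open>v\<close>.\<close>

lemma attached_at_beyond: "attached_at G v (branch G u v - {{u, v}})"
proof -
  have u: "u \<notin> e" if e: "e \<in> branch G u v - {{u, v}}" for e
  proof
    assume "u \<in> e"
    have "e \<in> edges G" using e by (simp add: branch_def)
    then obtain x where x: "e = {u, x}" using tree_edgeE[OF tree _ \<open>u \<in> e\<close>] by metis
    have "u \<notin> branch_verts G u v"
      using branch_verts_root[of u v G] tree_edge_neq[OF tree edge] by simp
    then have "x \<in> branch_verts G u v" using e x by (auto simp: branch_def)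
    then show False using branch_verts_edge_root[OF tree edge] x \<open>e \<in> edges G\<close> e by auto
  qed
  then show ?thesis
    using attached_at_branch unfolding attached_at_def by blast
qed

text \<open>The branch is the least set attached at \<open>u\<close> that contains
  \<open>{u, v}\<close>: starting from \<open>v\<close>, membership in \<open>X\<close> spreads
  along edges as long as \<open>u\<close> is avoided.\<close>

lemma branch_subset:
  assumes "attached_at G u X" "{u, v} \<in> X"
  shows "branch G u v \<subseteq> X"
proof
  have uv: "u \<noteq> v" using tree_edge_neq[OF tree edge] .
  fix e assume "e \<in> branch G u v"
  then obtain x where x: "x \<in> e" "x \<in> branch_verts G u v" and e: "e \<in> edges G"
    by (auto simp: branch_def)
  from x(2) have "x \<noteq> u \<and> (\<exists>f\<in>X. x \<in> f)"
  proof (induction rule: branch_verts_induct)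
    case refl
    then show ?case using assms uv by blast
  next
    case (step x y)
    then have "{x, y} \<in> X" using assms(1) unfolding attached_at_def by blast
    then show ?case using step by blast
  qed
  then show "e \<in> X" using assms(1) x e unfolding attached_at_def by blast
qed

end

section \<open>Connectivity and leaves\<close>

lemma tree_reachable:
  assumes "is_tree G" "u \<in> verts G" "v \<in> verts G" "u \<in> S"
    and "\<And>x y. x \<in> S \<Longrightarrow> {x, y} \<in> edges G \<Longrightarrow> y \<in> S"
  shows "v \<in> S"
proof -
  obtain xs where xs: "path_between G u xs v"
    using assms(1-3) unfolding is_tree_def connected_ugraph_def by blast
  have "xs ! i \<in> S" if "i < length xs" for i
    using that
  proof (induction i)
    case 0
    then show ?case using xs assms by (auto simp: path_between_def hd_conv_nth)
  next
    case (Suc i)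
    then have "{xs ! i, xs ! Suc i} \<in> edges G"
      using xs walk_edges_nth[of i xs] by (auto simp: path_between_def)
    then show ?case using Suc assms(5) by (meson Suc_lessD)
  qed
  then show ?thesis using xs by (auto simp: path_between_def last_conv_nth)
qed

text \<open>If no edge of \<open>X\<close> contained \<open>v\<close>, the vertices covered by
  \<open>X\<close> would be closed under adjacency, and connectivity would put \<open>v\<close>
  among them.\<close>

lemma attached_at_obtains_edge:
  assumes "is_tree G" "attached_at G v X" "X \<noteq> {}" "v \<in> verts G"
  obtains r where "{v, r} \<in> X"
proof -
  obtain e where e: "e \<in> X" using assms by auto
  then have eE: "e \<in> edges G" using assms by (auto simp: attached_at_def)
  then have "card e = 2" using assms(1) by (auto simp: is_tree_def simple_ugraph_def)
  then obtain x where "x \<in> e" by fastforce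
  then have "x \<in> verts G" using eE assms(1) by (auto simp: is_tree_def simple_ugraph_def)
  have "v \<in> \<Union>X"
  proof (rule ccontr)
    assume v: "v \<notin> \<Union>X"
    have "v \<in> \<Union>X"
    proof (rule tree_reachable[OF assms(1) \<open>x \<in> verts G\<close> assms(4)])
      show "x \<in> \<Union>X" using e \<open>x \<in> e\<close> by blast
      fix x y assume "x \<in> \<Union>X" "{x, y} \<in> edges G"
      then have "{x, y} \<in> X" using assms(2) v unfolding attached_at_def by blast
      then show "y \<in> \<Union>X" by blast
    qed
    then show False using v by simp
  qed
  then obtain f where f: "f \<in> X" "v \<in> f" by blast
  then have "f \<in> edges G" using assms by (auto simp: attached_at_def)
  then show thesis using tree_edgeE[OF assms(1) _ f(2)] f that by metis
qed

text \<open>Take an oriented edge \<open>(u, v)\<close> with the largest branch. A further edge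
  \<open>{u, w}\<close> would make the branch at \<open>w\<close> through \<open>u\<close> strictly
  larger.\<close>

lemma leaf_edge_exists:
  assumes "is_tree G" "edges G \<noteq> {}"
  obtains u v where "{u, v} \<in> edges G" "\<forall>e\<in>edges G. u \<in> e \<longrightarrow> e = {u, v}"
proof -
  define D where "D = {(u, v). {u, v} \<in> edges G}"
  obtain e where e: "e \<in> edges G" using assms by auto
  then have "card e = 2" using assms(1) by (auto simp: is_tree_def simple_ugraph_def)
  then have "D \<noteq> {}" using e by (auto simp: card_2_iff D_def)
  have "finite D"
  proof (rule finite_subset)
    show "D \<subseteq> verts G \<times> verts G"
      using assms(1) by (auto simp: D_def is_tree_def simple_ugraph_def)
    show "finite (verts G \<times> verts G)" using assms(1) by (auto simp: is_tree_def simple_ugraph_def)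
  qed
  obtain p where p: "p \<in> D" "\<And>q. q \<in> D \<Longrightarrow>
      card (case_prod (branch G) q) \<le> card (case_prod (branch G) p)"
  proof -
    define M where "M = Max ((\<lambda>q. card (case_prod (branch G) q)) ` D)"
    have "M \<in> (\<lambda>q. card (case_prod (branch G) q)) ` D"
      unfolding M_def using \<open>finite D\<close> \<open>D \<noteq> {}\<close> by (intro Max_in) auto
    then obtain p where "p \<in> D" "card (case_prod (branch G) p) = M" by force
    moreover have "card (case_prod (branch G) q) \<le> M" if "q \<in> D" for q
      unfolding M_def using \<open>finite D\<close> that by (intro Max_ge) auto
    ultimately show ?thesis using that by blast
  qed
  obtain u v where uv: "p = (u, v)" by force
  have E: "{u, v} \<in> edges G" using p uv by (simp add: D_def)
  show thesis
  proof (intro that[OF E] ballI impI, rule ccontr)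
    fix e assume e: "e \<in> edges G" "u \<in> e" "e \<noteq> {u, v}"
    then obtain w where w: "e = {u, w}" "u \<noteq> w"
      using tree_edgeE[OF assms(1)] by metis
    have wu: "{w, u} \<in> edges G" using e w by (simp add: insert_commute)
    have "{u, v} \<in> branch G w u - {{w, u}}"
      using E e w by (auto simp: branch_def branch_verts_refl doubleton_eq_iff)
    \<comment> \<open>The larger branch without \<open>{w, u}\<close> is attached at
      \<open>u\<close> and contains \<open>{u, v}\<close>, hence all of \<open>branch G u v\<close>;
      the edge \<open>{w, u}\<close> makes the inclusion strict.\<close>
    then have "branch G u v \<subseteq> branch G w u - {{w, u}}"
      using branch_subset[OF assms(1) E attached_at_beyond[OF assms(1) wu]] by simp
    moreover have "finite (branch G w u)"
      using finite_edges[OF assms(1)] by (simp add: branch_def)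
    moreover have "{w, u} \<in> branch G w u" using edge_in_branch[OF assms(1) wu] .
    ultimately have "card (branch G u v) < card (branch G w u)"
      by (intro psubset_card_mono) auto
    then show False using p(2)[of "(w, u)"] wu uv by (auto simp: D_def)
  qed
qed

section \<open>Existence of a split with a prescribed number of edges\<close>

lemma splits_at_edge_exists:
  assumes tree: "is_tree G" and k: "1 \<le> k" "k \<le> 3" "k < card (edges G)"
  shows "\<exists>c X. splits_at_edge G c X \<and> card X = k"
proof (rule ccontr)
  assume none: "\<not> ?thesis"
  have fin: "finite (edges G)" by (rule finite_edges[OF tree])
  define P where "P = (\<lambda>(v, c, X). attached_at G v X \<and> c \<in> edges G - X \<and> v \<in> c \<and> k \<le> card X)"
  have "edges G \<noteq> {}" using k by auto
  then obtain u v where uv: "{u, v} \<in> edges G" "\<forall>e\<in>edges G. u \<in> e \<longrightarrow> e = {u, v}"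
    by (rule leaf_edge_exists[OF tree])
  \<comment> \<open>As \<open>u\<close> is a leaf, all other edges together hang at
    \<open>v\<close>. There are at least \<open>k\<close> of them, so the minimum below is taken
    over a nonempty family.\<close>
  then have "attached_at G v (edges G - {{u, v}})"
    unfolding attached_at_def by blast
  then have "P (v, {u, v}, edges G - {{u, v}})"
    using k fin uv(1) by (simp add: P_def)
  then obtain t where t: "P t" "\<And>s. P s \<Longrightarrow> card (snd (snd t)) \<le> card (snd (snd s))"
    using ex_has_least_nat[of P _ "\<lambda>s. card (snd (snd s))"] by blast
  obtain v c X where "t = (v, c, X)" by (cases t) auto
  with t have X: "attached_at G v X" "c \<in> edges G" "c \<notin> X" "v \<in> c" "k \<le> card X"
    and least: "\<And>v' c' X'. attached_at G v' X' \<Longrightarrow> c' \<in> edges G - X' \<Longrightarrow> v' \<in> c' \<Longrightarrow>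
      k \<le> card X' \<Longrightarrow> card X \<le> card X'"
    by (fastforce simp: P_def)+
  have finX: "finite X" using X fin by (auto simp: attached_at_def intro: finite_subset)
  have v: "v \<in> verts G" using X tree by (auto simp: is_tree_def simple_ugraph_def)
  have "card X \<noteq> k" using none attached_at_splits[OF X(1)] X by blast
  \<comment> \<open>Let \<open>s\<close> be the size of the branch. Minimality rules out size at
    least \<open>k\<close> both for the branch without \<open>{v, r}\<close> and for the rest of
    \<open>X\<close>; size \<open>s = k\<close> would give a split at \<open>c\<close>. So
    \<open>s < k\<close>, \<open>card X - s < k\<close> and \<open>card X > k\<close>, which with
    \<open>k\<close> at most 3 forces the stated numbers.\<close>
  have br: "k = 3 \<and> card (branch G v r) = 2 \<and> card X = 4 \<and> branch G v r \<subseteq> X"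
    if r: "{v, r} \<in> X" for r
  proof -
    have vr: "{v, r} \<in> edges G" using r X by (auto simp: attached_at_def)
    have sub: "branch G v r \<subseteq> X" using branch_subset[OF tree vr X(1) r] .
    have mem: "{v, r} \<in> branch G v r" using edge_in_branch[OF tree vr] .
    have finB: "finite (branch G v r)" using sub finX finite_subset by blast
    have s: "card (branch G v r) \<ge> 1" using mem finB by (simp add: Suc_le_eq card_gt_0_iff) blast
    have le: "card (branch G v r) \<le> card X" using card_mono[OF finX sub] .
    have "card (branch G v r - {{v, r}}) = card (branch G v r) - 1"
      using mem finB by simp
    then have "card (branch G v r) - 1 < k"
      using least[OF attached_at_beyond[OF tree vr], of "{v, r}"] vr s le by fastforce
    moreover have "card (branch G v r) \<noteq> k"
      using none attached_at_splits[OF attached_at_branch[OF tree vr], of c] X sub by blast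
    moreover have "card (X - branch G v r) < k"
      using least[OF attached_at_diff[OF X(1) attached_at_branch[OF tree vr]], of c] X s le
        card_Diff_subset[OF finB sub] by fastforce
    ultimately show ?thesis
      using card_Diff_subset[OF finB sub] s le sub k X(5) \<open>card X \<noteq> k\<close> by auto
  qed
  have "X \<noteq> {}" using X k by auto
  then obtain r where r: "{v, r} \<in> X" by (rule attached_at_obtains_edge[OF tree X(1) _ v])
  have vr: "{v, r} \<in> edges G" using r X by (auto simp: attached_at_def)
  have rest: "attached_at G v (X - branch G v r)"
    by (rule attached_at_diff[OF X(1) attached_at_branch[OF tree vr]])
  have "card (X - branch G v r) = 2"
    using br[OF r] finX card_Diff_subset[of "branch G v r" X] finite_subset by fastforce
  then have "X - branch G v r \<noteq> {}" by (metis card.empty zero_neq_numeral)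
  then obtain r' where r': "{v, r'} \<in> X - branch G v r"
    by (rule attached_at_obtains_edge[OF tree rest _ v])
  have vr': "{v, r'} \<in> edges G" using r' X by (auto simp: attached_at_def)
  have sub': "branch G v r' \<subseteq> X - branch G v r" by (rule branch_subset[OF tree vr' rest r'])
  define Z where "Z = (branch G v r - {{v, r}}) \<union> branch G v r'"
  have mem: "{v, r} \<in> branch G v r" by (rule edge_in_branch[OF tree vr])
  have "splits_at_edge G {v, r} Z"
    unfolding splits_at_edge_def
  proof (intro conjI ballI)
    show "{v, r} \<in> edges G" by (rule vr)
    show "Z \<subseteq> edges G - {{v, r}}"
      using sub' mem by (auto simp: Z_def branch_def)
    fix e f assume e: "e \<in> Z" and f: "f \<in> edges G - Z - {{v, r}}"
    show "e \<inter> f \<subseteq> {v, r}"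
    \<comment> \<open>The two parts of \<open>Z\<close> touch the outside at different ends of
      \<open>{v, r}\<close>: \<open>branch G v r'\<close> at \<open>v\<close>, the remaining edge at
      \<open>r\<close>.\<close>
    proof (cases "e \<in> branch G v r'")
      case True
      moreover have "f \<in> edges G - branch G v r'" using f by (simp add: Z_def)
      ultimately have "e \<inter> f \<subseteq> {v}"
        by (rule attached_atD[OF attached_at_branch[OF tree vr']])
      then show ?thesis by blast
    next
      case False
      then have "e \<in> branch G v r - {{v, r}}" using e by (simp add: Z_def)
      moreover have "f \<in> edges G - (branch G v r - {{v, r}})" using f unfolding Z_def by blast
      ultimately have "e \<inter> f \<subseteq> {r}"
        by (rule attached_atD[OF attached_at_beyond[OF tree vr]])
      then show ?thesis by blast
    qed
  qed
  moreover have "card Z = 3"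
  proof -
    have "finite (branch G v r)" "finite (branch G v r')"
      using br[OF r] sub' finX by (meson finite_subset finite_Diff)+
    moreover have "card (branch G v r) = 2" "card (branch G v r') = 2"
      using br r r' by auto
    ultimately show ?thesis
      unfolding Z_def using sub' mem by (subst card_Un_disjoint) auto
  qed
  ultimately show False using none br[OF r] by auto
qed

section \<open>Paths across a split\<close>

lemma splits_at_edge_sym:
  "splits_at_edge G c X \<Longrightarrow> splits_at_edge G c (edges G - X - {c})"
  unfolding splits_at_edge_def by blast

lemma splits_at_edge_path:
  assumes tree: "is_tree G" and split: "splits_at_edge G c X" and b: "b \<in> X"
    and e: "e \<in> edges G - X" and f: "f \<in> edges G - X" and path: "edge_path G e xs f"
  shows "b \<notin> set (walk_edges xs)"
proof
  assume "b \<in> set (walk_edges xs)"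
  then obtain i where i: "b = {xs ! i, xs ! Suc i}" "Suc i < length xs"
    by (auto simp: set_walk_edges)
  obtain u v where p: "path_between G u xs v" and uv: "u \<in> e" "v \<in> f"
    using path by (auto simp: edge_path_def)
  have ends: "xs ! 0 \<in> e" "xs ! (length xs - 1) \<in> f"
    using p uv by (auto simp: path_between_def hd_conv_nth last_conv_nth)
  have E: "{xs ! j, xs ! Suc j} \<in> edges G" if "Suc j < length xs" for j
    using p walk_edges_nth[OF that] by (auto simp: path_between_def)
  have meet: "x \<in> c" if "x \<in> g" "x \<in> h" "g \<in> X" "h \<in> edges G - X" for x g h
    using split that unfolding splits_at_edge_def by blast
  \<comment> \<open>Go back along consecutive edges of \<open>X\<close>. The run starts after an
    edge outside \<open>X\<close> or at the start of the path, which lies on \<open>e\<close>;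
    either way its first vertex is in \<open>c\<close>.\<close>
  have before: "\<exists>j\<le>i. xs ! j \<in> c" if "{xs ! i, xs ! Suc i} \<in> X" "Suc i < length xs" for i
    using that
  proof (induction i)
    case 0
    then show ?case using meet[OF _ ends(1) _ e] by auto
  next
    case (Suc i)
    show ?case
    proof (cases "{xs ! i, xs ! Suc i} \<in> X")
      case True
      then show ?thesis using Suc by (metis Suc_lessD le_SucI)
    next
      case False
      then have "{xs ! i, xs ! Suc i} \<in> edges G - X" using E[of i] Suc by simp
      then have "xs ! Suc i \<in> c" using meet[of "xs ! Suc i", OF _ _ Suc.prems(1)] by blast
      then show ?thesis by blast
    qed
  qed
  \<comment> \<open>The mirror image, by induction on the number \<open>d\<close> of path edges
    after the one at position \<open>i\<close>.\<close>
  have after: "\<exists>j>i. j < length xs \<and> xs ! j \<in> c"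
    if "{xs ! i, xs ! Suc i} \<in> X" "Suc i + d = length xs - 1" "Suc i < length xs" for i d
    using that
  proof (induction d arbitrary: i)
    case 0
    then have "xs ! Suc i \<in> f" using ends by simp
    then have "xs ! Suc i \<in> c" using meet[OF _ _ 0(1) f] by blast
    then show ?case using 0 by blast
  next
    case (Suc d)
    show ?case
    proof (cases "{xs ! Suc i, xs ! Suc (Suc i)} \<in> X")
      case True
      moreover have "Suc (Suc i) + d = length xs - 1" "Suc (Suc i) < length xs"
        using Suc.prems by linarith+
      ultimately have "\<exists>j>Suc i. j < length xs \<and> xs ! j \<in> c" by (rule Suc.IH)
      then show ?thesis by (meson Suc_lessD)
    next
      case False
      then have "{xs ! Suc i, xs ! Suc (Suc i)} \<in> edges G - X" using E[of "Suc i"] Suc by simp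
      then have "xs ! Suc i \<in> c" using meet[of "xs ! Suc i", OF _ _ Suc.prems(1)] by blast
      then show ?thesis using Suc.prems by blast
    qed
  qed
  obtain j where j: "j \<le> i" "xs ! j \<in> c" using before[of i] i b by auto
  have "Suc i + (length xs - 1 - Suc i) = length xs - 1" using i by linarith
  then obtain k where k: "i < k" "k < length xs" "xs ! k \<in> c"
    using after i b by metis
  have c: "c \<in> edges G" "c \<notin> X" using split by (auto simp: splits_at_edge_def)
  have "xs ! j \<noteq> xs ! k"
    using p j k by (simp add: path_between_def nth_eq_iff_index_eq)
  moreover obtain w where "c = {xs ! j, w}" by (rule tree_edgeE[OF tree c(1) j(2)])
  \<comment> \<open>Positions \<open>j\<close> and \<open>k\<close> lie on either side of the edge
    \<open>b\<close> and carry both ends of \<open>c\<close>. Since \<open>c\<close> cannot be a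
    chord of the path, it is the path edge at \<open>i\<close>, that is \<open>b\<close>.\<close>
  ultimately have ck: "c = {xs ! j, xs ! k}" using k(3) by auto
  have "j < k" using j k by simp
  then have "k = Suc j"
    using path_chord_free[OF tree p _ k(2)] c(1) ck by simp
  moreover from this have "i = j" using j(1) k(1) by linarith
  ultimately have "b = c" using i ck by simp
  then show False using b c by simp
qed

section \<open>Unlinked sets and the bijection onto the edges of \<open>T\<close>\<close>

lemma unlinked_sym: "unlinked G p q \<longleftrightarrow> unlinked G q p"
  by (auto simp: unlinked_def)

text \<open>A singleton has no two distinct edges to test, and in the other direction every path
  contains zero edges of \<open>{b}\<close>.\<close>

lemma unlinked_singleton:
  assumes "b \<notin> q" "\<And>e f xs. e \<in> q \<Longrightarrow> f \<in> q \<Longrightarrow> edge_path G e xs f \<Longrightarrow> b \<notin> set (walk_edges xs)"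
  shows "unlinked G {b} q" "unlinked G q {b}"
proof -
  show "unlinked G {b} q"
    using assms by (fastforce simp: unlinked_def catches_on_def)
  then show "unlinked G q {b}" by (simp add: unlinked_sym)
qed

text \<open>\<open>S\<close> is one class of a 2-colouring, so each edge of the path switches
  membership.\<close>

lemma path_between_colour:
  assumes "path_between G u xs v" "\<And>x y. {x, y} \<in> edges G \<Longrightarrow> x \<in> S \<longleftrightarrow> y \<notin> S"
  shows "(u \<in> S \<longleftrightarrow> v \<in> S) \<longleftrightarrow> even (length (walk_edges xs))"
proof -
  have "xs \<noteq> []" "set (walk_edges xs) \<subseteq> edges G" "u = hd xs" "v = last xs"
    using assms by (auto simp: path_between_def)
  then show ?thesis
  proof (induction xs arbitrary: u rule: walk_edges.induct)
    case (3 x y xs)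
    then have "{x, y} \<in> edges G" by simp
    then show ?case using 3 assms(2)[of x y] by auto
  qed auto
qed

theorem mainTheorem4:
  fixes n m :: nat and G :: "'a ugraph" and T :: "'b ugraph"
  assumes "n \<ge> 1" and "m \<in> {2, 3, 4}"
    and "is_CB n m G"
    and "is_tree T" and "card (edges T) = card (edges G)"
  shows "friendly G T"
proof -
  from assms(3) obtain c1 c2 A B where c: "c1 \<noteq> c2"
    and A: "finite A" "card A = n - 1" and B: "finite B" "card B = m - 1"
    and AB: "A \<inter> B = {}" "{c1, c2} \<inter> (A \<union> B) = {}"
    and V: "verts G = {c1, c2} \<union> A \<union> B"
    and E: "edges G = {{c1, c2}} \<union> (\<lambda>a. {c1, a}) ` A \<union> (\<lambda>b. {c2, b}) ` B"
    unfolding is_CB_def by (elim conjE exE) (rule that; assumption)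
  have d: "A \<inter> B = {}" "c1 \<notin> A" "c1 \<notin> B" "c2 \<notin> A" "c2 \<notin> B"
    using AB by auto
  define EA where "EA = (\<lambda>a. {c1, a}) ` A"
  define EB where "EB = (\<lambda>b. {c2, b}) ` B"
  have finT: "finite (edges T)" using finite_edges[OF assms(4)] .
  have cardT: "card (edges T) = n + m - 1" using is_CB_card_edges[OF assms(3)] assms(5) by simp
  \<comment> \<open>Here \<open>m - 1\<close> lies between 1 and 3 and is less than
    \<open>n + m - 1\<close> because \<open>n\<close> is positive.\<close>
  have "\<exists>c X. splits_at_edge T c X \<and> card X = m - 1"
    using splits_at_edge_exists[OF assms(4), of "m - 1"] assms(1,2) cardT by auto
  then obtain e0 X where split: "splits_at_edge T e0 X" and cX: "card X = m - 1" by blast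
  define Y where "Y = edges T - X - {e0}"
  have splitY: "splits_at_edge T e0 Y" unfolding Y_def by (rule splits_at_edge_sym[OF split])
  have e0: "e0 \<in> edges T" "e0 \<notin> X" "X \<subseteq> edges T" using split by (auto simp: splits_at_edge_def)
  have finX: "finite X" using e0 finT finite_subset by blast
  have cY: "card Y = n - 1"
    using e0 finX finT cX cardT assms(1,2) by (auto simp: Y_def card_Diff_subset)
  have inj: "inj_on (\<lambda>a. {c1, a}) A" "inj_on (\<lambda>b. {c2, b}) B"
    using d by (auto simp: inj_on_def doubleton_eq_iff)
  have "card EA = card Y" "card EB = card X"
    using A B cX cY by (simp_all add: EA_def EB_def card_image inj)
  moreover have finY: "finite Y" using finT by (simp add: Y_def)
  ultimately obtain g h where g: "bij_betw g EA Y" and h: "bij_betw h EB X"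
    using finX A B finite_same_card_bij[of EA Y] finite_same_card_bij[of EB X]
    by (auto simp: EA_def EB_def)
  have EE: "{c1, c2} \<notin> EA" "{c1, c2} \<notin> EB" "EA \<inter> EB = {}"
    using c d by (auto simp: EA_def EB_def doubleton_eq_iff)
  define \<phi> where "\<phi> e = (if e = {c1, c2} then e0 else if e \<in> EA then g e else h e)" for e
  have \<phi>c: "\<phi> {c1, c2} = e0" by (simp add: \<phi>_def)
  have \<phi>A: "bij_betw \<phi> EA Y" using EE by (intro iffD2[OF bij_betw_cong g]) (auto simp: \<phi>_def)
  have \<phi>B: "bij_betw \<phi> EB X" using EE by (intro iffD2[OF bij_betw_cong h]) (auto simp: \<phi>_def)
  have "bij_betw \<phi> ({{c1, c2}} \<union> EA \<union> EB) ({e0} \<union> Y \<union> X)"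
    using \<phi>A \<phi>B e0 by (intro bij_betw_combine) (auto simp: Y_def bij_betw_def \<phi>c)
  moreover have "{e0} \<union> Y \<union> X = edges T" using e0 by (auto simp: Y_def)
  ultimately have bij: "bij_betw \<phi> (edges G) (edges T)" by (simp add: E EA_def EB_def)
  have imA: "\<phi> ` EA = Y" and imB: "\<phi> ` EB = X" using \<phi>A \<phi>B by (auto simp: bij_betw_def)
  \<comment> \<open>Leaves have singleton coboundaries, so every pair to be checked has at least one
    singleton; the two centers are adjacent and never form such a pair.\<close>
  have co: "coboundary G c1 = {{c1, c2}} \<union> EA" "coboundary G c2 = {{c1, c2}} \<union> EB"
    "\<And>a. a \<in> A \<Longrightarrow> coboundary G a = {{c1, a}}" "\<And>b. b \<in> B \<Longrightarrow> coboundary G b = {{c2, b}}"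
    using c d by (auto simp: coboundary_def E EA_def EB_def)
  have im1: "\<phi> ` coboundary G c1 = insert e0 Y" and im2: "\<phi> ` coboundary G c2 = insert e0 X"
    by (simp_all add: co \<phi>c imA imB)
  have imb: "\<exists>x\<in>X. \<phi> ` coboundary G b = {x}" if "b \<in> B" for b
    using that imB by (auto simp: co EB_def)
  have ima: "\<exists>y\<in>Y. \<phi> ` coboundary G a = {y}" if "a \<in> A" for a
    using that imA by (auto simp: co EA_def)
  have unlX: "unlinked T {b} q" "unlinked T q {b}" if "b \<in> X" "q \<subseteq> edges T - X" for b q
    using that by (intro unlinked_singleton splits_at_edge_path[OF assms(4) split]; blast)+
  have unlY: "unlinked T {b} q" "unlinked T q {b}" if "b \<in> Y" "q \<subseteq> edges T - Y" for b q
    using that by (intro unlinked_singleton splits_at_edge_path[OF assms(4) splitY]; blast)+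
  \<comment> \<open>The image of each center's coboundary avoids the side that receives the leaf
    edges of the other center, as \<open>unlX\<close> and \<open>unlY\<close> require.\<close>
  have subX: "insert e0 X \<subseteq> edges T - Y" and subY: "insert e0 Y \<subseteq> edges T - X"
    using e0 by (auto simp: Y_def)
  have single: "unlinked T {x} {y}" if "x \<noteq> y" for x y
    using that by (auto simp: unlinked_def catches_on_def)
  have single': "unlinked T (\<phi> ` coboundary G P) (\<phi> ` coboundary G Q)"
    if "P \<noteq> Q" "coboundary G P = {{w, P}}" "coboundary G Q = {{w, Q}}" for P Q w
  proof -
    have "{w, P} \<in> edges G" "{w, Q} \<in> edges G"
      using that(2,3) by (auto simp: coboundary_def)
    moreover have "{w, P} \<noteq> {w, Q}" using that(1) by (simp add: doubleton_eq_iff)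
    ultimately have "\<phi> {w, P} \<noteq> \<phi> {w, Q}"
      using bij unfolding bij_betw_def inj_on_def by blast
    then show ?thesis using single that by simp
  qed
  have "unlinked T (\<phi> ` coboundary G P) (\<phi> ` coboundary G Q)"
    if PQ: "P \<in> verts G" "Q \<in> verts G" "P \<noteq> Q" "path_between G P xs Q" "even (length (walk_edges xs))"
    for P Q xs
  proof -
    \<comment> \<open>The colour classes of \<open>CB(n, m)\<close> are
      \<open>{c1} \<union> B\<close> and \<open>{c2} \<union> A\<close>; an even path stays within
      one class.\<close>
    have "(P \<in> {c1} \<union> B \<longleftrightarrow> Q \<in> {c1} \<union> B) \<longleftrightarrow> even (length (walk_edges xs))"
      by (rule path_between_colour[OF PQ(4)]) (use c d in \<open>auto simp: E doubleton_eq_iff\<close>)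
    with PQ have "P \<in> {c1} \<union> B \<longleftrightarrow> Q \<in> {c1} \<union> B" by simp
    then consider "P = c1" "Q \<in> B" | "P \<in> B" "Q = c1" | "P = c2" "Q \<in> A" | "P \<in> A" "Q = c2"
      | "P \<in> A \<and> Q \<in> A \<or> P \<in> B \<and> Q \<in> B"
      using PQ c d by (auto simp: V)
    then show ?thesis
    proof cases
      case 1
      then show ?thesis using imb[of Q] unlX(2)[OF _ subY] im1 by fastforce
    next
      case 2
      then show ?thesis using imb[of P] unlX(1)[OF _ subY] im1 by fastforce
    next
      case 3
      then show ?thesis using ima[of Q] unlY(2)[OF _ subX] im2 by fastforce
    next
      case 4
      then show ?thesis using ima[of P] unlY(1)[OF _ subX] im2 by fastforce
    next
      case 5
      then show ?thesis using single'[OF PQ(3)] co(3,4) by blast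
    qed
  qed
  then show ?thesis unfolding friendly_def using bij by blast
qed

end
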